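(* Let $H$ be a separable complex Hilbert space. Let $S$ be a bounded operator on $H$ such that $0\notin\overline{W(S)}$. Let $T$ be an unbounded, densely defined linear operator in $H$ which is hyponormal and invertible. If $ST\subset T^*S$, then $T$ is self-adjoint, i.e. $T=T^*$.
   Context: The numerical range of a bounded operator $S$ on $H$ is $W(S)=\{\langle Sx,x\rangle: x\in H,\ \|x\|=1\}$, and $\overline{W(S)}$ is its closure in $\mathbb{C}$. "Unbounded" is used in the sense "not necessarily bounded". A densely defined operator $T$ is hyponormal if $D(T)\subset D(T^* )$ and $\|T^*x\|\le\|Tx\|$ for all $x\in D(T)$. An operator $T$ is invertible if there is an everywhere defined bounded operator $T^{-1}$ on $H$ such that $T^{-1}T\subset TT^{-1}=I$, where $I$ is the identity on $H$. For operators $A,B$, $A\subset B$ means $D(A)\subset D(B)$ and $Ax=Bx$ for all $x\in D(A)$. Products are defined by $(AB)x=A(Bx)$ on $D(AB)=\{x\in D(B): Bx\in D(A)\}$. Equality of operators includes equality of domains. *)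

theory Defs
  imports "HOL-Analysis.Analysis"
begin

text \<open>
  A complex Hilbert space is a complete real inner product space with a compatible complex scalar
  multiplication and a sesquilinear form (linear in the first argument) whose real part is the
  underlying real inner product. No complex inner product space is excluded: the real part of
  its inner product always is a real inner product inducing the same norm.
\<close>

class complex_hilbert_space = real_inner + complete_space +
  fixes scaleC :: "complex \<Rightarrow> 'a \<Rightarrow> 'a"  (infixr \<open>*\<^sub>C\<close> 75)
    and cinner :: "'a \<Rightarrow> 'a \<Rightarrow> complex"
  assumes scaleC_add_right: "a *\<^sub>C (x + y) = a *\<^sub>C x + a *\<^sub>C y"
    and scaleC_add_left: "(a + b) *\<^sub>C x = a *\<^sub>C x + b *\<^sub>C x"
    and scaleC_scaleC: "a *\<^sub>C (b *\<^sub>C x) = (a * b) *\<^sub>C x"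
    and scaleC_of_real: "complex_of_real r *\<^sub>C x = r *\<^sub>R x"
    and cinner_commute: "cinner x y = cnj (cinner y x)"
    and cinner_add_left: "cinner (x + y) z = cinner x z + cinner y z"
    and cinner_scaleC_left: "cinner (a *\<^sub>C x) y = a * cinner x y"
    and Re_cinner: "Re (cinner x y) = inner x y"

lemma cinner_self: "cinner x x = complex_of_real ((norm x)\<^sup>2)"
  for x :: "'a::complex_hilbert_space"
proof (rule complex_eqI)
  have "Im (cinner x x) = - Im (cinner x x)"
    using arg_cong[OF cinner_commute[of x x], of Im] by simp
  then show "Im (cinner x x) = Im (complex_of_real ((norm x)\<^sup>2))"
    by simp
qed (simp add: Re_cinner power2_norm_eq_inner)

instantiation complex :: complex_hilbert_space
begin

definition scaleC_complex :: "complex \<Rightarrow> complex \<Rightarrow> complex"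
  where "scaleC_complex = (*)"

definition cinner_complex :: "complex \<Rightarrow> complex \<Rightarrow> complex"
  where "cinner_complex x y = x * cnj y"

instance
  by standard
    (auto simp: scaleC_complex_def cinner_complex_def inner_complex_def scaleR_conv_of_real
      algebra_simps)

end

text \<open>
  A not necessarily bounded operator in the space is a partial map: \<open>dom T\<close> is its domain and
  \<open>the (T x)\<close> its value at \<open>x\<close> in the domain. Then \<open>A \<subseteq>\<^sub>m B\<close> is operator extension, \<open>A \<circ>\<^sub>m B\<close> is the
  product with its natural domain, \<open>Some\<close> is the identity operator, and equality includes
  equality of domains.
\<close>

type_synonym 'a operator = "'a \<rightharpoonup> 'a"

definition linear_operator :: "'a::complex_hilbert_space operator \<Rightarrow> bool" where
  "linear_operator T \<longleftrightarrow>
     0 \<in> dom T \<and>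
     (\<forall>x\<in>dom T. \<forall>y\<in>dom T. T (x + y) = Some (the (T x) + the (T y))) \<and>
     (\<forall>a. \<forall>x\<in>dom T. T (a *\<^sub>C x) = Some (a *\<^sub>C the (T x)))"

definition densely_defined :: "'a::complex_hilbert_space operator \<Rightarrow> bool" where
  "densely_defined T \<longleftrightarrow> closure (dom T) = UNIV"

definition bounded_operator :: "'a::complex_hilbert_space operator \<Rightarrow> bool" where
  "bounded_operator S \<longleftrightarrow>
     linear_operator S \<and> dom S = UNIV \<and> (\<exists>K. \<forall>x. norm (the (S x)) \<le> K * norm x)"

text \<open>The adjoint is meaningful only for densely defined operators; only then is the vector \<open>z\<close> unique.\<close>

definition adjoint_operator :: "'a::complex_hilbert_space operator \<Rightarrow> 'a operator" where
  "adjoint_operator T = (\<lambda>y.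
     if \<exists>z. \<forall>x\<in>dom T. cinner (the (T x)) y = cinner x z
     then Some (THE z. \<forall>x\<in>dom T. cinner (the (T x)) y = cinner x z)
     else None)"

lemma adjoint_operator_eq_Some_iff:
  assumes "densely_defined T"
  shows "adjoint_operator T y = Some z \<longleftrightarrow> (\<forall>x\<in>dom T. cinner (the (T x)) y = cinner x z)"
proof -
  have uniq: "u = v"
    if u: "\<forall>x\<in>dom T. cinner (the (T x)) y = cinner x u"
      and v: "\<forall>x\<in>dom T. cinner (the (T x)) y = cinner x v" for u v
  proof -
    have "inner x u = inner x v" if "x \<in> dom T" for x
      using u v that by (metis Re_cinner)
    then have "dom T \<subseteq> {x. inner x (u - v) = 0}"
      by (auto simp: inner_diff_right)
    moreover have "closed {x. inner x (u - v) = 0}"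
      by (intro closed_Collect_eq continuous_intros)
    ultimately have "closure (dom T) \<subseteq> {x. inner x (u - v) = 0}"
      by (rule closure_minimal)
    then have "inner (u - v) (u - v) = 0"
      using assms unfolding densely_defined_def by blast
    then show ?thesis by simp
  qed
  show ?thesis
  proof
    assume a: "adjoint_operator T y = Some z"
    then have ex: "\<exists>z. \<forall>x\<in>dom T. cinner (the (T x)) y = cinner x z"
      by (auto simp: adjoint_operator_def split: if_splits)
    then have "\<exists>!z. \<forall>x\<in>dom T. cinner (the (T x)) y = cinner x z"
      using uniq by blast
    from theI'[OF this] show "\<forall>x\<in>dom T. cinner (the (T x)) y = cinner x z"
      using a ex by (auto simp: adjoint_operator_def)
  next
    assume a: "\<forall>x\<in>dom T. cinner (the (T x)) y = cinner x z"
    then have "(THE z. \<forall>x\<in>dom T. cinner (the (T x)) y = cinner x z) = z"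
      using uniq by (intro the_equality) blast+
    then show "adjoint_operator T y = Some z"
      using a by (auto simp: adjoint_operator_def)
  qed
qed

definition hyponormal :: "'a::complex_hilbert_space operator \<Rightarrow> bool" where
  "hyponormal T \<longleftrightarrow>
     densely_defined T \<and>
     dom T \<subseteq> dom (adjoint_operator T) \<and>
     (\<forall>x\<in>dom T. norm (the (adjoint_operator T x)) \<le> norm (the (T x)))"

definition invertible_operator :: "'a::complex_hilbert_space operator \<Rightarrow> bool" where
  "invertible_operator T \<longleftrightarrow>
     (\<exists>B. bounded_operator B \<and> B \<circ>\<^sub>m T \<subseteq>\<^sub>m T \<circ>\<^sub>m B \<and> T \<circ>\<^sub>m B = Some)"

definition numerical_range :: "'a::complex_hilbert_space operator \<Rightarrow> complex set" where
  "numerical_range S = {cinner (the (S x)) x | x. norm x = 1}"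

end

theory Submission
  imports Defs
begin

text \<open>
  Everything happens for the bounded inverse \<open>B = T\<^sup>-\<^sup>1\<close>. The relation \<open>S T \<subseteq> T\<^sup>* S\<close> says that \<open>B\<close> is
  symmetric for the form \<open>\<langle>S x, y\<rangle>\<close>, in the sense that \<open>\<langle>S B x, y\<rangle> = \<langle>S x, B y\<rangle>\<close>. Hence, for real
  \<open>\<epsilon>\<close> and \<open>J = \<i> \<epsilon> B\<close>, the form takes the same value at \<open>w + J w\<close> and at \<open>w - J w\<close>, so it is
  invariant under the Cayley transform \<open>U = (1 + J) (1 - J)\<^sup>-\<^sup>1\<close>. As \<open>\<bar>\<langle>S w, w\<rangle>\<bar> \<ge> \<delta> \<parallel>w\<parallel>\<^sup>2\<close> with
  \<open>\<delta> > 0\<close>, the orbits of \<open>U\<close> are bounded in both time directions.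

  Hyponormality acts in the opposite direction: it makes \<open>n \<mapsto> \<parallel>U\<^sup>n x\<parallel>\<^sup>2\<close> convex. A bounded convex
  function on the integers is constant, so the inequality behind convexity is an equality. That
  inequality is \<open>Re \<langle>T\<^sup>* B v, v\<rangle> \<le> \<parallel>v\<parallel>\<^sup>2\<close> for \<open>v = B y\<close>, where \<open>T\<^sup>* B\<close> is a contraction because \<open>T\<close> is
  hyponormal; the equality case of Cauchy-Schwarz gives \<open>T\<^sup>* B v = v\<close> on the range of \<open>B\<close>. This
  range is the dense domain of \<open>T\<close>, so \<open>B\<close> is symmetric, and an operator whose bounded inverse is
  symmetric is self-adjoint.
\<close>

section \<open>Contractions whose Cayley transform has bounded orbits\<close>

lemma convex_bounded_seq_first_step:
  fixes a :: "nat \<Rightarrow> real"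
  assumes convex: "\<And>n. 2 * a (Suc n) \<le> a (Suc (Suc n)) + a n"
    and bounded: "\<And>n. a n \<le> C"
  shows "a 1 \<le> a 0"
proof (rule ccontr)
  define d where "d = a 1 - a 0"
  assume "\<not> a 1 \<le> a 0"
  then have d: "d > 0" by (simp add: d_def)
  have step: "d \<le> a (Suc n) - a n" for n
  proof (induction n)
    case (Suc n)
    then show ?case using convex[of n] by linarith
  qed (simp add: d_def)
  have growth: "a 0 + real n * d \<le> a n" for n
  proof (induction n)
    case (Suc n)
    then show ?case using step[of n] by (simp add: algebra_simps)
  qed simp
  obtain n :: nat where "C - a 0 < real n * d"
    using reals_Archimedean3[OF d] by blast
  then show False using growth[of n] bounded[of n] by linarith
qed

lemma contraction_identity_minus_surj:
  fixes J :: "'a::{real_normed_vector, complete_space} \<Rightarrow> 'a"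
  assumes "linear J" and contr: "\<And>x. norm (J x) \<le> c * norm x" and "0 \<le> c" "c < 1"
  shows "\<exists>x. x - J x = y"
proof -
  interpret linear J by fact
  have "dist (y + J u) (y + J v) \<le> c * dist u v" for u v
    using contr[of "u - v"] by (simp add: dist_norm diff)
  then have "\<exists>!x\<in>UNIV. y + J x = x"
    using assms by (intro Banach_fix[where c = c]) (auto simp: complete_UNIV)
  then obtain x where "y + J x = x" by blast
  then show ?thesis by (metis add_diff_cancel_right')
qed

text \<open>
  With \<open>V = 1 + J\<close> and \<open>W = 1 - J\<close>, the hypothesis \<open>accretive\<close> is the parallelogram law's
  translation of \<open>2 \<parallel>V W y\<parallel>\<^sup>2 \<le> \<parallel>V V y\<parallel>\<^sup>2 + \<parallel>W W y\<parallel>\<^sup>2\<close>. It makes the squared norms convex along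
  each orbit of the Cayley transform \<open>V W\<^sup>-\<^sup>1\<close>. The function \<open>q\<close> is constant on these orbits and
  dominates \<open>\<delta>\<close> times the squared norm, so the orbits are bounded, and a bounded convex sequence
  indexed by the naturals decreases.
\<close>

lemma cayley_transform_norm_le:
  fixes J :: "'a::{real_inner, complete_space} \<Rightarrow> 'a" and q :: "'a \<Rightarrow> real"
  assumes lin: "linear J" and contr: "\<And>x. norm (J x) \<le> c * norm x" and c: "0 \<le> c" "c < 1"
    and accretive: "\<And>y. 0 \<le> (norm (J y))\<^sup>2 + inner (J (J y)) y"
    and "\<delta> > 0" and coercive: "\<And>w. \<delta> * (norm w)\<^sup>2 \<le> q w"
    and invariant: "\<And>y. q (y + J y) = q (y - J y)"
  shows "norm (y + J y) \<le> norm (y - J y)"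
proof -
  interpret linear J by fact
  define V W where "V = (\<lambda>x. x + J x)" and "W = (\<lambda>x. x - J x)"
  have VW: "V (W x) = W (V x)" for x
    by (simp add: V_def W_def add diff)
  have W_surj: "\<exists>x. W x = y" for y
    unfolding W_def using contraction_identity_minus_surj[OF lin contr c] .
  have convex: "2 * (norm (V (W y)))\<^sup>2 \<le> (norm (V (V y)))\<^sup>2 + (norm (W (W y)))\<^sup>2" for y
    using accretive[of y] unfolding power2_norm_eq_inner
    by (simp add: V_def W_def add diff inner_simps inner_commute)
  \<comment> \<open>The sequence \<open>w n\<close> below is the orbit of \<open>W y\<close>. The factors \<open>W W\<close> clear the denominators
    in three consecutive terms, which are \<open>W W z\<close>, \<open>V W z\<close> and \<open>V V z\<close> for \<open>z = x n\<close>.\<close>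
  obtain y0 where y0: "W y0 = y" using W_surj by blast
  obtain s where s: "\<And>x. W (s x) = V x"
    using choice[of "\<lambda>x y. W y = V x"] W_surj by blast
  define x where "x n = (s ^^ n) y0" for n
  have x_step: "W (x (Suc n)) = V (x n)" for n
    by (simp add: x_def s)
  define w where "w n = W (W (x n))" for n
  have w1: "w (Suc n) = V (W (x n))" for n
    by (simp add: w_def x_step VW)
  have w2: "w (Suc (Suc n)) = V (V (x n))" for n
    by (simp add: w1 x_step)
  have q_const: "q (w n) = q (w 0)" for n
  proof (induction n)
    case (Suc n)
    then show ?case using invariant[of "W (x n)"] by (simp add: w1) (simp add: w_def V_def W_def)
  qed simp
  have bound: "(norm (w n))\<^sup>2 \<le> q (w 0) / \<delta>" for n
    using coercive[of "w n"] \<open>\<delta> > 0\<close> q_const[of n] by (simp add: pos_le_divide_eq mult.commute)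
  have "(norm (w 1))\<^sup>2 \<le> (norm (w 0))\<^sup>2"
  proof (rule convex_bounded_seq_first_step[OF _ bound])
    show "2 * (norm (w (Suc n)))\<^sup>2 \<le> (norm (w (Suc (Suc n))))\<^sup>2 + (norm (w n))\<^sup>2" for n
      using convex[of "x n"] unfolding w2 by (simp add: w1) (simp add: w_def)
  qed
  then have "norm (w 1) \<le> norm (w 0)" by (simp add: power_mono_iff)
  moreover have "w 1 = V y" "w 0 = W y"
    using w1[of 0] by (simp_all add: w_def x_def y0)
  ultimately show ?thesis by (simp add: V_def W_def)
qed

text \<open>
  The hypotheses are symmetric under \<open>J \<mapsto> - J\<close>, so both the Cayley transform and its
  inverse are contractive. It is therefore isometric, and convexity holds with equality.
\<close>

lemma cayley_bounded_accretive_eq: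
  fixes J :: "'a::{real_inner, complete_space} \<Rightarrow> 'a" and q :: "'a \<Rightarrow> real"
  assumes lin: "linear J" and contr: "\<And>x. norm (J x) \<le> c * norm x" and c: "0 \<le> c" "c < 1"
    and accretive: "\<And>y. 0 \<le> (norm (J y))\<^sup>2 + inner (J (J y)) y"
    and \<delta>: "\<delta> > 0" and coercive: "\<And>w. \<delta> * (norm w)\<^sup>2 \<le> q w"
    and invariant: "\<And>y. q (y + J y) = q (y - J y)"
  shows "(norm (J y))\<^sup>2 + inner (J (J y)) y = 0"
proof -
  interpret linear J by fact
  have le: "norm (x + J x) \<le> norm (x - J x)" for x
    using cayley_transform_norm_le[OF assms] .
  have ge: "norm (x - J x) \<le> norm (x + J x)" for x
    using cayley_transform_norm_le[of "\<lambda>x. - J x" c \<delta> q x] lin contr c accretive \<delta> coercive invariant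
    by (simp add: linear_compose_neg neg)
  have iso: "inner x (J x) = 0" for x
  proof -
    have "(norm (x + J x))\<^sup>2 = (norm (x - J x))\<^sup>2"
      using le[of x] ge[of x] by simp
    then show ?thesis
      unfolding power2_norm_eq_inner by (simp add: inner_simps inner_commute)
  qed
  \<comment> \<open>At \<open>y + J y\<close> the form \<open>inner x (J x)\<close> differs from its values at \<open>y\<close> and \<open>J y\<close> by exactly
    the cross terms \<open>inner y (J (J y)) + inner (J y) (J y)\<close>.\<close>
  show ?thesis
    using iso[of "y + J y"] iso[of y] iso[of "J y"] unfolding power2_norm_eq_inner
    by (simp add: add inner_simps inner_commute)
qed

section \<open>Complex inner products\<close>

lemma cinner_add_right: "cinner x (y + z) = cinner x y + cinner x z"
  for x :: "'a::complex_hilbert_space"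
  by (metis cinner_add_left cinner_commute complex_cnj_add)

lemma cinner_scaleC_right: "cinner x (a *\<^sub>C y) = cnj a * cinner x y"
  for x :: "'a::complex_hilbert_space"
  by (metis cinner_scaleC_left cinner_commute complex_cnj_mult)

lemma norm_scaleC: "norm (a *\<^sub>C x) = cmod a * norm x"
  for x :: "'a::complex_hilbert_space"
proof -
  have "cinner (a *\<^sub>C x) (a *\<^sub>C x) = (a * cnj a) * cinner x x"
    by (simp add: cinner_scaleC_left cinner_scaleC_right)
  also have "\<dots> = complex_of_real ((cmod a * norm x)\<^sup>2)"
    unfolding complex_norm_square[symmetric] cinner_self power_mult_distrib of_real_mult ..
  finally have "cinner (a *\<^sub>C x) (a *\<^sub>C x) = complex_of_real ((cmod a * norm x)\<^sup>2)" .
  then have "(norm (a *\<^sub>C x))\<^sup>2 = (cmod a * norm x)\<^sup>2"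
    unfolding cinner_self using of_real_eq_iff by blast
  then show ?thesis by simp
qed

lemma inner_cinner_ext:
  fixes y z :: "'a::complex_hilbert_space"
  assumes "\<And>u. cinner u y = cinner u z"
  shows "y = z"
proof -
  have "inner (y - z) y = inner (y - z) z"
    using assms[of "y - z"] by (metis Re_cinner)
  then have "inner (y - z) (y - z) = 0" by (simp add: inner_diff_right)
  then show ?thesis by simp
qed

text \<open>
  The constant is a lower bound for the distance of \<open>0\<close> from the numerical range; the quadratic form is
  homogeneous of degree two, so the bound on the unit sphere spreads to all vectors.
\<close>

lemma numerical_range_coercive:
  fixes S :: "'a::complex_hilbert_space operator"
  assumes lin: "linear_operator S" and total: "dom S = UNIV"
    and nz: "0 \<notin> closure (numerical_range S)"
  obtains \<delta> where "\<delta> > 0" and "\<And>x. \<delta> * (norm x)\<^sup>2 \<le> cmod (cinner (the (S x)) x)"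
proof -
  obtain \<delta> where \<delta>: "\<delta> > 0" and far: "\<And>z. z \<in> numerical_range S \<Longrightarrow> \<delta> \<le> cmod z"
    using nz unfolding closure_approachable by (auto simp: not_less dist_norm)
  have "\<delta> * (norm x)\<^sup>2 \<le> cmod (cinner (the (S x)) x)" for x
  proof (cases "x = 0")
    case False
    define a where "a = complex_of_real (inverse (norm x))"
    have "S (a *\<^sub>C x) = Some (a *\<^sub>C the (S x))"
      using lin total by (simp add: linear_operator_def)
    moreover have "norm (a *\<^sub>C x) = 1"
      using False by (simp add: norm_scaleC a_def norm_inverse)
    ultimately have "cinner (a *\<^sub>C the (S x)) (a *\<^sub>C x) \<in> numerical_range S"
      unfolding numerical_range_def by (smt (verit) mem_Collect_eq option.sel)
    from far[OF this] have "\<delta> \<le> inverse (norm x) * inverse (norm x) * cmod (cinner (the (S x)) x)"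
      by (simp add: cinner_scaleC_left cinner_scaleC_right a_def norm_mult norm_inverse)
    then show ?thesis using False
      by (simp add: field_simps power2_eq_square)
  qed simp
  then show ?thesis using that \<delta> by blast
qed

section \<open>Self-adjointness\<close>

text \<open>This is the equality case of the Cauchy-Schwarz inequality.\<close>

lemma eq_if_norm_le_inner_eq:
  fixes u v :: "'a::real_inner"
  assumes "norm u \<le> norm v" and "inner u v = (norm v)\<^sup>2"
  shows "u = v"
proof -
  have "(norm (u - v))\<^sup>2 = (norm u)\<^sup>2 - (norm v)\<^sup>2"
    using assms(2) unfolding power2_norm_eq_inner by (simp add: inner_simps inner_commute)
  also have "\<dots> \<le> 0"
    using assms(1) by (simp add: power_mono)
  finally show ?thesis by simp
qed

lemma self_adjoint_if_symmetric_inverse: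
  fixes T :: "'a::complex_hilbert_space operator"
  assumes dense: "densely_defined T"
    and right: "\<And>x. T (B x) = Some x" and left: "\<And>x. x \<in> dom T \<Longrightarrow> B (the (T x)) = x"
    and symmetric: "\<And>u v. cinner u (B v) = cinner (B u) v"
  shows "T = adjoint_operator T"
proof -
  have "T y = Some z \<longleftrightarrow> adjoint_operator T y = Some z" for y z
  proof
    assume "T y = Some z"
    then have "B z = y" using left[of y] by auto
    then have "cinner (the (T x)) y = cinner x z" if "x \<in> dom T" for x
      using symmetric[of "the (T x)" z] left[OF that] by simp
    then show "adjoint_operator T y = Some z"
      by (simp add: adjoint_operator_eq_Some_iff[OF dense])
  next
    assume "adjoint_operator T y = Some z"
    then have adj: "cinner (the (T x)) y = cinner x z" if "x \<in> dom T" for x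
      using that unfolding adjoint_operator_eq_Some_iff[OF dense] by blast
    have "cinner u y = cinner u (B z)" for u
      using adj[of "B u"] by (simp add: right symmetric domIff)
    then have "y = B z" by (rule inner_cinner_ext)
    then show "T y = Some z" by (simp add: right)
  qed
  then have "T y = adjoint_operator T y" for y
    by (metis not_None_eq)
  then show ?thesis by blast
qed

theorem theorem3p2:
  fixes S T :: "'a::complex_hilbert_space operator"
  assumes "separable_space (euclidean :: 'a topology)"
    and "bounded_operator S"
    and "0 \<notin> closure (numerical_range S)"
    and "linear_operator T"
    and "densely_defined T"
    and "hyponormal T"
    and "invertible_operator T"
    and "S \<circ>\<^sub>m T \<subseteq>\<^sub>m adjoint_operator T \<circ>\<^sub>m S"
  shows "T = adjoint_operator T"
proof -
  obtain B' where B': "bounded_operator B'" "B' \<circ>\<^sub>m T \<subseteq>\<^sub>m T \<circ>\<^sub>m B'" "T \<circ>\<^sub>m B' = Some"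
    using assms(7) unfolding invertible_operator_def by blast
  define B where "B x = the (B' x)" for x
  define s where "s x = the (S x)" for x
  have B'_eq: "B' x = Some (B x)" for x
    using B'(1) unfolding bounded_operator_def B_def by (metis UNIV_I domD option.sel)
  have S_eq: "S x = Some (s x)" for x
    using assms(2) unfolding bounded_operator_def s_def by (metis UNIV_I domD option.sel)
  have S_lin: "linear_operator S" "dom S = UNIV"
    using assms(2) by (auto simp: bounded_operator_def)
  have s_add: "s (x + y) = s x + s y" and s_scale: "s (a *\<^sub>C x) = a *\<^sub>C s x" for x y a
    using S_lin by (simp_all add: linear_operator_def s_def)
  have B_add: "B (x + y) = B x + B y" and B_scale: "B (a *\<^sub>C x) = a *\<^sub>C B x" for x y a
    using B'(1) by (simp_all add: linear_operator_def bounded_operator_def B_def)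
  have right: "T (B x) = Some x" for x
    using fun_cong[OF B'(3), of x] by (simp add: map_comp_def B'_eq)
  have B_dom: "B x \<in> dom T" for x by (simp add: right domIff)
  have left: "B (the (T x)) = x" if x: "x \<in> dom T" for x
  proof -
    obtain y where y: "T x = Some y" using x by blast
    have "x \<in> dom (B' \<circ>\<^sub>m T)"
      using y by (simp add: map_comp_def B'_eq dom_def)
    then have "(B' \<circ>\<^sub>m T) x = (T \<circ>\<^sub>m B') x" using B'(2) unfolding map_le_def by blast
    then show ?thesis using y right[of x] by (simp add: B'(3)) (simp add: map_comp_def B'_eq)
  qed

  \<comment> \<open>Hyponormality turns into the statement that \<open>R = T\<^sup>* B\<close> is a contraction with \<open>B\<^sup>* R = B\<close>.\<close>
  define R where "R x = the (adjoint_operator T (B x))" for x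
  have R: "adjoint_operator T (B x) = Some (R x)" for x
  proof -
    have "B x \<in> dom (adjoint_operator T)"
      using assms(6) B_dom[of x] unfolding hyponormal_def by blast
    then show ?thesis by (auto simp: R_def)
  qed
  have R_norm: "norm (R x) \<le> norm x" for x
  proof -
    have "norm (R x) \<le> norm (the (T (B x)))"
      using assms(6) B_dom[of x] unfolding hyponormal_def R_def by blast
    then show ?thesis by (simp add: right)
  qed
  have adjD: "cinner u y = cinner (B u) z" if "adjoint_operator T y = Some z" for u y z
  proof -
    have "cinner (the (T (B u))) y = cinner (B u) z"
      using that B_dom[of u] unfolding adjoint_operator_eq_Some_iff[OF assms(5)] by blast
    then show ?thesis by (simp add: right)
  qed
  have R_adj: "cinner u (B x) = cinner (B u) (R x)" for u x
    by (rule adjD[OF R])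
  \<comment> \<open>This is \<open>S B = B\<^sup>* S\<close> in weak form.\<close>
  have inter: "cinner u (s (B x)) = cinner (B u) (s x)" for u x
  proof -
    have "B x \<in> dom (S \<circ>\<^sub>m T)" by (simp add: map_comp_def right S_eq dom_def)
    then have "(S \<circ>\<^sub>m T) (B x) = (adjoint_operator T \<circ>\<^sub>m S) (B x)"
      using assms(8) unfolding map_le_def by blast
    then have "adjoint_operator T (s (B x)) = Some (s x)"
      by (simp add: map_comp_def right S_eq)
    then show ?thesis by (rule adjD)
  qed

  obtain K where K: "\<And>x. norm (B x) \<le> K * norm x"
    using B'(1) by (auto simp: bounded_operator_def B_def)
  \<comment> \<open>The scaling makes \<open>J\<close> a strict contraction.\<close>
  define e where "e = 1 / (\<bar>K\<bar> + 1)"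
  define J where "J x = (\<i> * complex_of_real e) *\<^sub>C B x" for x
  have e: "e > 0" by (simp add: e_def add_nonneg_pos)
  have J_lin: "linear J"
  proof
    show "J (x + y) = J x + J y" for x y by (simp add: J_def B_add scaleC_add_right)
    show "J (r *\<^sub>R x) = r *\<^sub>R J x" for r x
      unfolding J_def by (metis B_scale mult.commute scaleC_of_real scaleC_scaleC)
  qed
  have J_norm: "norm (J x) = e * norm (B x)" for x
    using e by (simp add: J_def norm_scaleC norm_mult)
  have J_contr: "norm (J x) \<le> (e * \<bar>K\<bar>) * norm x" for x
  proof -
    have "norm (B x) \<le> \<bar>K\<bar> * norm x"
      using K[of x] by (meson abs_ge_self mult_right_mono norm_ge_zero order_trans)
    then show ?thesis using e by (simp add: J_norm mult.assoc)
  qed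
  have JJ: "inner (J (J y)) y = - e\<^sup>2 * inner (R (B y)) (B y)" for y
  proof -
    have "J (J y) = complex_of_real (- e\<^sup>2) *\<^sub>C B (B y)"
      by (simp add: J_def B_scale scaleC_scaleC power2_eq_square algebra_simps)
    then have "inner (J (J y)) y = - e\<^sup>2 * inner y (B (B y))"
      by (simp only: scaleC_of_real) (simp add: inner_commute)
    also have "inner y (B (B y)) = inner (R (B y)) (B y)"
      using arg_cong[OF R_adj[of y "B y"], of Re] by (simp add: Re_cinner inner_commute)
    finally show ?thesis .
  qed
  obtain \<delta> where \<delta>: "\<delta> > 0" and coercive: "\<And>x. \<delta> * (norm x)\<^sup>2 \<le> cmod (cinner (s x) x)"
    using numerical_range_coercive[OF S_lin assms(3)] unfolding s_def by blast
  have R_eq: "R (B y) = B y" for y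
  proof (rule eq_if_norm_le_inner_eq)
    show "norm (R (B y)) \<le> norm (B y)" by (rule R_norm)
    have "(norm (J y))\<^sup>2 + inner (J (J y)) y = 0"
    proof (rule cayley_bounded_accretive_eq[OF J_lin J_contr])
      show "0 \<le> e * \<bar>K\<bar>" "e * \<bar>K\<bar> < 1" using e by (simp_all add: e_def)
      show "0 \<le> (norm (J y))\<^sup>2 + inner (J (J y)) y" for y
      proof -
        have "inner (R (B y)) (B y) \<le> norm (R (B y)) * norm (B y)" by (rule norm_cauchy_schwarz)
        also have "\<dots> \<le> (norm (B y))\<^sup>2"
          using R_norm[of "B y"] by (simp add: power2_eq_square mult_right_mono)
        finally show ?thesis
          by (simp add: JJ J_norm power_mult_distrib mult_left_mono)
      qed
      show "\<delta> > 0" by (rule \<delta>)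
      show "\<delta> * (norm w)\<^sup>2 \<le> cmod (cinner (s w) w)" for w by (rule coercive)
      show "cmod (cinner (s (y + J y)) (y + J y)) = cmod (cinner (s (y - J y)) (y - J y))" for y
      proof -
        have cross: "cinner (s (J y)) y + cinner (s y) (J y) = 0"
        proof -
          have "cinner (s (B y)) y = cinner (s y) (B y)"
            using inter[of y y] by (metis cinner_commute)
          then show ?thesis
            by (simp add: J_def s_scale cinner_scaleC_left cinner_scaleC_right)
        qed
        have neg: "- J y = (-1) *\<^sub>C J y"
          using scaleC_of_real[of "-1" "J y"] by simp
        have "cinner (s (y - J y)) (y - J y) =
          cinner (s y) y + cinner (s (J y)) (J y) - (cinner (s (J y)) y + cinner (s y) (J y))"
          unfolding diff_conv_add_uminus neg
          by (simp add: s_add s_scale cinner_add_left cinner_add_right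
              cinner_scaleC_left cinner_scaleC_right)
        moreover have "cinner (s (y + J y)) (y + J y) =
          cinner (s y) y + cinner (s (J y)) (J y) + (cinner (s (J y)) y + cinner (s y) (J y))"
          by (simp add: s_add cinner_add_left cinner_add_right)
        ultimately show ?thesis using cross by simp
      qed
    qed
    then have "e\<^sup>2 * ((norm (B y))\<^sup>2 - inner (R (B y)) (B y)) = 0"
      by (simp add: JJ J_norm power_mult_distrib algebra_simps)
    then show "inner (R (B y)) (B y) = (norm (B y))\<^sup>2"
      using e by simp
  qed
  have sym_dom: "cinner u (B v) = cinner (B u) v" if "v \<in> dom T" for u v
    using R_adj[of u v] R_eq[of "the (T v)"] left[OF that] by simp
  \<comment> \<open>Density extends the identity from \<open>dom T\<close> for the continuous real inner product; the
    imaginary part of \<open>cinner\<close> is then recovered by replacing \<open>u\<close> with \<open>\<i> *\<^sub>C u\<close>.\<close>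
  have sym_real: "inner u (B v) = inner (B u) v" for u v
  proof -
    have "bounded_linear B"
    proof (rule bounded_linear_intro)
      show "B (x + y) = B x + B y" for x y by (rule B_add)
      show "B (r *\<^sub>R x) = r *\<^sub>R B x" for r x by (metis B_scale scaleC_of_real)
      show "norm (B x) \<le> norm x * K" for x using K[of x] by (simp add: mult.commute)
    qed
    then have "closed {v. inner u (B v) = inner (B u) v}"
      by (intro closed_Collect_eq continuous_intros linear_continuous_on)
    moreover have "dom T \<subseteq> {v. inner u (B v) = inner (B u) v}"
    proof
      fix v assume "v \<in> dom T"
      then show "v \<in> {v. inner u (B v) = inner (B u) v}"
        using arg_cong[OF sym_dom[of v u], of Re] by (simp add: Re_cinner)
    qed
    ultimately have "closure (dom T) \<subseteq> {v. inner u (B v) = inner (B u) v}"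
      by (rule closure_minimal[rotated])
    then show ?thesis using assms(5) unfolding densely_defined_def by blast
  qed
  have "cinner u (B v) = cinner (B u) v" for u v
  proof (rule complex_eqI)
    show "Re (cinner u (B v)) = Re (cinner (B u) v)" by (simp add: Re_cinner sym_real)
    have "Re (cinner (\<i> *\<^sub>C u) (B v)) = Re (cinner (\<i> *\<^sub>C B u) v)"
      using sym_real[of "\<i> *\<^sub>C u" v] by (simp add: Re_cinner B_scale)
    then show "Im (cinner u (B v)) = Im (cinner (B u) v)" by (simp add: cinner_scaleC_left)
  qed
  then show ?thesis
    using self_adjoint_if_symmetric_inverse[OF assms(5) right left] by blast
qed

end
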